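(* Let $n_1,\ldots,n_5$ be positive integers such that $n_1 \geq n_2 \geq \cdots \geq n_5$. Then the complete $5$-partite graph $K_{n_1,n_2,\ldots,n_5}$ is competitively orientable if and only if one of the following holds: (a) $n_1=3$, $n_2=3$, $n_3 \geq 2$, and $n_4=1$; (b) $n_1\geq 4$, $n_3 \geq 2$, and $n_4 =1$; (c) $n_4 \geq 2$.
   Context: All graphs are finite and simple. An orientation of a graph $G$ is a digraph $D$ on the vertex set $V(G)$ with no loops, no multiple arcs and no directed $2$-cycles, whose underlying graph (with edge set $\{uv \mid (u,v)\in A(D)\}$) is $G$. A digraph $D$ is competitive if every pair of distinct vertices $x,y$ has a common out-neighbor, i.e. there is a vertex $z$ with $(x,z),(y,z)\in A(D)$. A graph is competitively orientable if it has a competitive orientation. $K_{n_1,\ldots,n_k}$ denotes the complete $k$-partite graph with partite sets of sizes $n_1,\ldots,n_k$. *)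

theory Defs
  imports "Graph_Theory.Graph_Theory"
begin

text \<open>
  As in the library, an undirected simple graph is a symmetric loopfree digraph
  (\<^locale>\<open>pair_graph\<close>): an edge \<open>uv\<close> is represented by both arcs \<open>(u, v)\<close> and \<open>(v, u)\<close>.
\<close>

text \<open>
  Multiple arcs are excluded by the type \<^typ>\<open>'a pair_pre_digraph\<close>, loops by
  \<^locale>\<open>pair_digraph\<close>, and directed 2-cycles by the asymmetry condition. The equation also
  says that \<open>D\<close> and \<open>G\<close> have the same vertex set.
\<close>
definition orientation :: "'a pair_pre_digraph \<Rightarrow> 'a pair_pre_digraph \<Rightarrow> bool" where
  "orientation G D \<longleftrightarrow>
     pair_digraph D \<and>
     (\<forall>u v. (u, v) \<in> parcs D \<longrightarrow> (v, u) \<notin> parcs D) \<and>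
     mk_symmetric (with_proj D) = G"

definition competitive :: "('a, 'b) pre_digraph \<Rightarrow> bool" where
  "competitive D \<longleftrightarrow>
     (\<forall>x \<in> verts D. \<forall>y \<in> verts D. x \<noteq> y \<longrightarrow>
        (\<exists>z \<in> verts D. x \<rightarrow>\<^bsub>D\<^esub> z \<and> y \<rightarrow>\<^bsub>D\<^esub> z))"

definition competitively_orientable :: "'a pair_pre_digraph \<Rightarrow> bool" where
  "competitively_orientable G \<longleftrightarrow> (\<exists>D. orientation G D \<and> competitive (with_proj D))"

text \<open>
  The vertex \<open>(i, j)\<close> is the \<open>j\<close>-th vertex of the \<open>i\<close>-th partite set (both counted from 0),
  which has size \<open>ns ! i\<close>.
\<close>
definition multipartite_verts :: "nat list \<Rightarrow> (nat \<times> nat) set" where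
  "multipartite_verts ns = {(i, j). i < length ns \<and> j < ns ! i}"

definition complete_multipartite :: "nat list \<Rightarrow> (nat \<times> nat) pair_pre_digraph" where
  "complete_multipartite ns =
     \<lparr> pverts = multipartite_verts ns,
       parcs = {(u, v). u \<in> multipartite_verts ns \<and> v \<in> multipartite_verts ns
                        \<and> fst u \<noteq> fst v} \<rparr>"

lemma multipartite_verts_Sigma:
  "multipartite_verts ns = (SIGMA i:{..<length ns}. {..<ns ! i})"
  by (auto simp: multipartite_verts_def)

lemma pair_graph_complete_multipartite: "pair_graph (complete_multipartite ns)"
proof -
  let ?V = "multipartite_verts ns"
  have "finite ?V"
    by (simp add: multipartite_verts_Sigma)
  moreover have "parcs (complete_multipartite ns) \<subseteq> ?V \<times> ?V"
    by (auto simp: complete_multipartite_def)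
  ultimately have "finite (parcs (complete_multipartite ns))"
    by (meson finite_SigmaI finite_subset)
  with \<open>finite ?V\<close> show ?thesis
    by unfold_locales
      (auto simp: complete_multipartite_def symmetric_def sym_def)
qed

end

theory Submission
  imports Defs
begin

text \<open>
  Enlarging a part by twins of one of its vertices keeps an orientation competitive, so only
  minimal and maximal cases matter: \<open>K\<^bsub>3,3,2,1,1\<^esub>\<close>, \<open>K\<^bsub>4,2,2,1,1\<^esub>\<close> and \<open>K\<^bsub>2,2,2,2,1\<^esub>\<close> have
  explicit competitive orientations, while \<open>K\<^bsub>a,b,1,1,1\<^esub>\<close> and \<open>K\<^bsub>3,2,2,1,1\<^esub>\<close> have none. For
  \<open>K\<^bsub>a,b,1,1,1\<^esub>\<close>, every vertex of the two large parts dominates at least two of the three single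
  vertices \<open>c\<close>, \<open>d\<close>, \<open>e\<close>, so it is not a common out-neighbour of two of them. Hence each of
  \<open>c\<close>, \<open>d\<close>, \<open>e\<close> is dominated by the other two, which is absurd. For
  \<open>K\<^bsub>3,2,2,1,1\<^esub>\<close> the claim is a propositional problem with one variable for each of the 31 edges.
\<close>

section \<open>Competitive orientations as relations on the vertex set\<close>

text \<open>This replaces the digraph record by a bare relation, so that single instances can be
  evaluated or turned into propositional problems. One equivalence encodes both that parts are
  independent and that each edge between parts gets exactly one direction.\<close>

definition competitive_rel :: "('a \<times> 'b) set \<Rightarrow> ('a \<times> 'b \<Rightarrow> 'a \<times> 'b \<Rightarrow> bool) \<Rightarrow> bool" where
  "competitive_rel V E \<longleftrightarrow>
     (\<forall>u\<in>V. \<forall>v\<in>V. E u v \<longleftrightarrow> fst u \<noteq> fst v \<and> \<not> E v u) \<and>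
     (\<forall>x\<in>V. \<forall>y\<in>V. x \<noteq> y \<longrightarrow> (\<exists>z\<in>V. E x z \<and> E y z))"

lemma competitive_rel_arc:
  assumes "competitive_rel V E" "u \<in> V" "v \<in> V"
  shows "E u v \<longleftrightarrow> fst u \<noteq> fst v \<and> \<not> E v u"
  using assms unfolding competitive_rel_def by blast

lemma competitive_rel_arcD:
  assumes "competitive_rel V E" "u \<in> V" "v \<in> V" "E u v"
  shows "fst u \<noteq> fst v" "\<not> E v u"
  using competitive_rel_arc[OF assms(1-3)] assms(4) by auto

lemma competitive_rel_common:
  assumes "competitive_rel V E" "x \<in> V" "y \<in> V" "x \<noteq> y"
  obtains z where "z \<in> V" "E x z" "E y z"
  using assms unfolding competitive_rel_def by blast

lemma in_parcs_mk_symmetric: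
  "(u, v) \<in> parcs (mk_symmetric (with_proj D)) \<longleftrightarrow> (u, v) \<in> parcs D \<or> (v, u) \<in> parcs D"
  by (auto simp: parcs_mk_symmetric Bex_def)

lemma competitively_orientable_multipartite_iff:
  "competitively_orientable (complete_multipartite ns) \<longleftrightarrow>
     (\<exists>E. competitive_rel (multipartite_verts ns) E)"
proof
  let ?V = "multipartite_verts ns"
  assume "competitively_orientable (complete_multipartite ns)"
  then obtain D where D: "orientation (complete_multipartite ns) D" "competitive (with_proj D)"
    unfolding competitively_orientable_def by blast
  have asym: "(v, u) \<notin> parcs D" if "(u, v) \<in> parcs D" for u v
    using D(1) that unfolding orientation_def by blast
  have sym: "mk_symmetric (with_proj D) = complete_multipartite ns"
    using D(1) unfolding orientation_def by blast
  have verts: "pverts D = ?V"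
    using arg_cong[OF sym, of pverts] by (simp add: complete_multipartite_def)
  have "(u, v) \<in> parcs D \<or> (v, u) \<in> parcs D \<longleftrightarrow> u \<in> ?V \<and> v \<in> ?V \<and> fst u \<noteq> fst v" for u v
    by (simp add: in_parcs_mk_symmetric[symmetric] sym complete_multipartite_def)
  then have "competitive_rel ?V (\<lambda>u v. (u, v) \<in> parcs D)"
    using D(2) asym unfolding competitive_rel_def competitive_def
    by (simp add: verts) blast
  then show "\<exists>E. competitive_rel ?V E"
    by blast
next
  let ?V = "multipartite_verts ns"
  assume "\<exists>E. competitive_rel ?V E"
  then obtain E where E: "competitive_rel ?V E" ..
  \<comment> \<open>\<open>E\<close> may hold outside \<open>?V\<close>, so its arcs are cut down to
    \<open>?V\<close>.\<close>
  define D where "D = \<lparr>pverts = ?V, parcs = {(u, v). u \<in> ?V \<and> v \<in> ?V \<and> E u v}\<rparr>"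
  have fin: "finite ?V"
    by (simp add: multipartite_verts_Sigma)
  have "parcs D \<subseteq> ?V \<times> ?V"
    by (auto simp: D_def)
  then have "finite (parcs D)"
    using fin by (meson finite_SigmaI finite_subset)
  then have "pair_digraph D"
    using fin competitive_rel_arcD(1)[OF E] by unfold_locales (auto simp: D_def)
  moreover have "(v, u) \<notin> parcs D" if "(u, v) \<in> parcs D" for u v
    using that competitive_rel_arcD(2)[OF E] by (auto simp: D_def)
  moreover have "mk_symmetric (with_proj D) = complete_multipartite ns"
  proof -
    have "(u, v) \<in> parcs (mk_symmetric (with_proj D)) \<longleftrightarrow>
        (u, v) \<in> parcs (complete_multipartite ns)" for u v
      unfolding in_parcs_mk_symmetric
      using competitive_rel_arc[OF E, of u v] competitive_rel_arcD(1)[OF E, of v u]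
      by (auto simp: D_def complete_multipartite_def)
    then have "parcs (mk_symmetric (with_proj D)) = parcs (complete_multipartite ns)"
      by auto
    then show ?thesis
      by (simp add: pair_pre_digraph.equality D_def complete_multipartite_def)
  qed
  moreover have "competitive (with_proj D)"
    unfolding competitive_def
  proof (intro ballI impI)
    fix x y assume "x \<in> verts (with_proj D)" "y \<in> verts (with_proj D)" and "x \<noteq> y"
    then have xy: "x \<in> ?V" "y \<in> ?V"
      by (simp_all add: D_def)
    then obtain z where "z \<in> ?V" "E x z" "E y z"
      using competitive_rel_common[OF E _ _ \<open>x \<noteq> y\<close>] by blast
    with xy show "\<exists>z\<in>verts (with_proj D). x \<rightarrow>\<^bsub>with_proj D\<^esub> z \<and> y \<rightarrow>\<^bsub>with_proj D\<^esub> z"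
      by (intro bexI[of _ z]) (simp_all add: D_def)
  qed
  ultimately show "competitively_orientable (complete_multipartite ns)"
    unfolding competitively_orientable_def orientation_def by blast
qed

section \<open>Enlarging parts by twins\<close>

text \<open>The larger vertex set retracts onto the smaller one, part by part, and \<open>E\<close>
  is pulled back along this retraction. A common out-neighbour of the images is fixed by the
  retraction, so it also serves the original pair.\<close>

lemma competitively_orientable_multipartite_mono:
  assumes "competitively_orientable (complete_multipartite ns)"
    and le: "list_all2 (\<lambda>n m. 0 < n \<and> n \<le> m) ns ms" and "2 \<le> length ns"
  shows "competitively_orientable (complete_multipartite ms)"
proof -
  let ?V = "multipartite_verts ns" and ?W = "multipartite_verts ms"
  obtain E where E: "competitive_rel ?V E"
    using assms(1) unfolding competitively_orientable_multipartite_iff ..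
  have len: "length ms = length ns"
    using le by (simp add: list_all2_conv_all_nth)
  have le': "0 < ns ! i" "ns ! i \<le> ms ! i" if "i < length ns" for i
    using le that by (auto simp: list_all2_conv_all_nth)
  \<comment> \<open>The surplus vertices of a part become twins of the last old vertex of that part.\<close>
  define f where "f = (\<lambda>(i, j). (i, min j (ns ! i - 1)))"
  have f_mem: "f u \<in> ?V" if "u \<in> ?W" for u
    using that le' by (force simp: f_def multipartite_verts_def len min_def)
  have f_id: "z \<in> ?W" "f z = z" if "z \<in> ?V" for z
    using that le' by (force simp: f_def multipartite_verts_def len)+
  have fst_f: "fst (f u) = fst u" for u
    by (simp add: f_def split_beta)
  \<comment> \<open>This serves pairs of twins: they have the same image, which only has to have
    some out-neighbour. A second vertex, found in part 0 or 1, lets competitiveness supply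
    it.\<close>
  have out: "\<exists>z\<in>?V. E x z" if "x \<in> ?V" for x
  proof -
    have "0 < length ns" "1 < length ns"
      using \<open>2 \<le> length ns\<close> by auto
    then have "(0, 0) \<in> ?V" "(1, 0) \<in> ?V"
      using le'(1) unfolding multipartite_verts_def by blast+
    moreover have "x \<noteq> (0, 0) \<or> x \<noteq> (1, 0)"
      by auto
    ultimately obtain y where "y \<in> ?V" "x \<noteq> y"
      by blast
    then show ?thesis
      using competitive_rel_common[OF E that] by blast
  qed
  have "competitive_rel ?W (\<lambda>u v. E (f u) (f v))"
    unfolding competitive_rel_def
  proof (intro conjI ballI impI)
    fix u v assume "u \<in> ?W" "v \<in> ?W"
    then show "E (f u) (f v) \<longleftrightarrow> fst u \<noteq> fst v \<and> \<not> E (f v) (f u)"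
      using competitive_rel_arc[OF E f_mem f_mem] unfolding fst_f by blast
  next
    fix x y assume "x \<in> ?W" "y \<in> ?W"
    then have "\<exists>z\<in>?V. E (f x) z \<and> E (f y) z"
      using competitive_rel_common[OF E, of "f x" "f y"] out[of "f x"] f_mem by metis
    then show "\<exists>z\<in>?W. E (f x) (f z) \<and> E (f y) (f z)"
      using f_id by metis
  qed
  then show ?thesis
    unfolding competitively_orientable_multipartite_iff by blast
qed

section \<open>Explicit orientations of the minimal cases\<close>

text \<open>The list form makes quantifiers over the vertices executable.\<close>

lemma multipartite_verts_set:
  "multipartite_verts ns = set (concat (map (\<lambda>i. map (Pair i) [0..<ns ! i]) [0..<length ns]))"
  by (auto simp: multipartite_verts_def)

lemma competitively_orientable_33211:
  "competitively_orientable (complete_multipartite [3, 3, 2, 1, 1])"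
proof -
  \<comment> \<open>Out-neighbourhoods, found by a SAT solver (as in the next two lemmas).\<close>
  let ?N = "[((0, 0), [(1, 1), (1, 2), (2, 0), (3, 0)]),
             ((0, 1), [(1, 2), (2, 1), (3, 0), (4, 0)]),
             ((0, 2), [(1, 0), (1, 1), (2, 1), (4, 0)]),
             ((1, 0), [(0, 0), (0, 1), (2, 1), (3, 0)]),
             ((1, 1), [(0, 1), (2, 0), (4, 0)]),
             ((1, 2), [(0, 2), (3, 0), (4, 0)]),
             ((2, 0), [(0, 1), (0, 2), (1, 0), (1, 2)]),
             ((2, 1), [(0, 0), (1, 1), (1, 2), (4, 0)]),
             ((3, 0), [(0, 2), (1, 1), (2, 0), (2, 1)]),
             ((4, 0), [(0, 0), (1, 0), (2, 0), (3, 0)])] :: ((nat \<times> nat) \<times> (nat \<times> nat) list) list"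
  \<comment> \<open>Every vertex is a key of \<open>?N\<close>, so \<open>the\<close> never meets
    \<open>None\<close> here.\<close>
  have "competitive_rel (multipartite_verts [3, 3, 2, 1, 1]) (\<lambda>u v. v \<in> set (the (map_of ?N u)))"
    unfolding multipartite_verts_set competitive_rel_def by code_simp
  then show ?thesis
    unfolding competitively_orientable_multipartite_iff by blast
qed

lemma competitively_orientable_42211:
  "competitively_orientable (complete_multipartite [4, 2, 2, 1, 1])"
proof -
  let ?N = "[((0, 0), [(1, 1), (2, 1), (3, 0)]),
             ((0, 1), [(1, 0), (2, 1), (4, 0)]),
             ((0, 2), [(1, 1), (2, 0), (4, 0)]),
             ((0, 3), [(1, 0), (2, 0), (3, 0)]),
             ((1, 0), [(0, 0), (0, 2), (2, 0), (2, 1)]),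
             ((1, 1), [(0, 1), (0, 3), (2, 0), (2, 1)]),
             ((2, 0), [(0, 0), (0, 1), (3, 0), (4, 0)]),
             ((2, 1), [(0, 2), (0, 3), (3, 0), (4, 0)]),
             ((3, 0), [(0, 1), (0, 2), (1, 0), (1, 1), (4, 0)]),
             ((4, 0), [(0, 0), (0, 3), (1, 0), (1, 1)])] :: ((nat \<times> nat) \<times> (nat \<times> nat) list) list"
  have "competitive_rel (multipartite_verts [4, 2, 2, 1, 1]) (\<lambda>u v. v \<in> set (the (map_of ?N u)))"
    unfolding multipartite_verts_set competitive_rel_def by code_simp
  then show ?thesis
    unfolding competitively_orientable_multipartite_iff by blast
qed

lemma competitively_orientable_22221:
  "competitively_orientable (complete_multipartite [2, 2, 2, 2, 1])"
proof -
  let ?N = "[((0, 0), [(1, 1), (2, 1), (3, 0), (3, 1)]),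
             ((0, 1), [(1, 0), (2, 0), (3, 0), (3, 1)]),
             ((1, 0), [(0, 0), (3, 1), (4, 0)]),
             ((1, 1), [(0, 1), (3, 0), (4, 0)]),
             ((2, 0), [(0, 0), (1, 0), (1, 1), (3, 0)]),
             ((2, 1), [(0, 1), (1, 0), (1, 1), (3, 1)]),
             ((3, 0), [(1, 0), (2, 1), (4, 0)]),
             ((3, 1), [(1, 1), (2, 0), (4, 0)]),
             ((4, 0), [(0, 0), (0, 1), (2, 0), (2, 1)])] :: ((nat \<times> nat) \<times> (nat \<times> nat) list) list"
  have "competitive_rel (multipartite_verts [2, 2, 2, 2, 1]) (\<lambda>u v. v \<in> set (the (map_of ?N u)))"
    unfolding multipartite_verts_set competitive_rel_def by code_simp
  then show ?thesis
    unfolding competitively_orientable_multipartite_iff by blast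
qed

section \<open>The cases without a competitive orientation\<close>

lemma not_competitively_orientable_three_singletons:
  "\<not> competitively_orientable (complete_multipartite [a, b, 1, 1, 1])"
proof
  let ?V = "multipartite_verts [a, b, 1, 1, 1]"
  assume "competitively_orientable (complete_multipartite [a, b, 1, 1, 1])"
  then obtain E where E: "competitive_rel ?V E"
    unfolding competitively_orientable_multipartite_iff ..
  have parts: "fst u \<noteq> fst v" and asym: "\<not> E v u" if "u \<in> ?V" "v \<in> ?V" "E u v" for u v
    using competitive_rel_arcD[OF E that] by auto
  have irrefl: "\<not> E u u" if "u \<in> ?V" for u
    using parts[OF that that] by blast
  define T where "T = {(2, 0), (3, 0), (4, 0) :: nat \<times> nat}"
  have V_cases: "v \<in> T \<or> fst v = 0 \<or> fst v = 1" if "v \<in> ?V" for v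
    using that by (auto simp: T_def multipartite_verts_def less_Suc_eq nth_Cons' split: if_splits)
  have T_V: "T \<subseteq> ?V"
    by (auto simp: T_def multipartite_verts_def)
  \<comment> \<open>An out-neighbourhood contains a directed cycle, and a cycle that avoids the part of \<open>v\<close>
      needs two of the three singleton parts.\<close>
  have two: "E v x \<or> E v y"
    if v: "v \<in> ?V" "v \<notin> T" and xy: "x \<in> T" "y \<in> T" "x \<noteq> y" for v x y
  proof (rule ccontr)
    assume no: "\<not> (E v x \<or> E v y)"
    obtain z where z: "T = {x, y, z}"
      using xy unfolding T_def by auto
    have zV: "z \<in> ?V"
      using z T_V by blast
    have succ: "\<exists>w'\<in>?V. E v w' \<and> E w w'" if "w \<in> ?V" "E v w" for w
      using competitive_rel_common[OF E v(1) that(1)] irrefl[OF v(1)] that(2) by metis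
    \<comment> \<open>Since \<open>fst v\<close> is 0 or 1, \<open>1 - fst v\<close> is the other
      one of these two parts.\<close>
    have N_cases: "w = z \<or> fst w = 1 - fst v" if "w \<in> ?V" "E v w" for w
      using V_cases[OF that(1)] V_cases[OF v(1)] v(2) no z that(2) parts[OF v(1) that] by auto
    \<comment> \<open>The successor of \<open>w\<close> among the out-neighbours of \<open>v\<close>
      cannot lie in the part of \<open>w\<close>, so only \<open>z\<close> remains.\<close>
    have to_z: "E v z \<and> E w z" if w: "w \<in> ?V" "E v w" "w \<noteq> z" for w
    proof -
      obtain w' where w': "w' \<in> ?V" "E v w'" "E w w'"
        using succ[OF w(1,2)] by blast
      then have "w' = z"
        using N_cases[OF w(1,2)] N_cases[of w'] parts[of w w'] w by auto
      then show ?thesis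
        using w' by simp
    qed
    obtain w where "w \<in> ?V" "E v w"
      using competitive_rel_common[OF E v(1), of x] v(2) xy(1) T_V by blast
    then have "E v z"
      using to_z by blast
    \<comment> \<open>Now \<open>z\<close> needs such a successor \<open>w'\<close> too, but
      \<open>to_z\<close> gives the reverse arc from \<open>w'\<close> to \<open>z\<close>.\<close>
    then obtain w' where w': "w' \<in> ?V" "E v w'" "E z w'"
      using succ[of z] zV by blast
    then show False
      using to_z[of w'] asym[of z w'] irrefl[of z] zV by blast
  qed
  have third: "E x z \<and> E y z" if T: "T = {x, y, z}" and "x \<noteq> y" for x y z
  proof -
    have xy: "x \<in> T" "y \<in> T" "x \<in> ?V" "y \<in> ?V"
      using T T_V by auto
    obtain w where w: "w \<in> ?V" "E x w" "E y w"
      using competitive_rel_common[OF E xy(3,4) \<open>x \<noteq> y\<close>] by blast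
    have "\<not> E w x" "\<not> E w y"
      using w asym[of x w] asym[of y w] xy by auto
    then have "w \<in> T"
      using two[OF w(1) _ xy(1,2) \<open>x \<noteq> y\<close>] by blast
    moreover have "w \<noteq> x" "w \<noteq> y"
      using w irrefl xy by blast+
    ultimately show ?thesis
      using w T by simp
  qed
  have "E (2, 0) (4, 0)" "E (4, 0) (2, 0)"
    using third[of "(2, 0)" "(3, 0)" "(4, 0)"] third[of "(3, 0)" "(4, 0)" "(2, 0)"]
    by (auto simp: T_def)
  then show False
    using asym[of "(2, 0)" "(4, 0)"] T_V by (auto simp: T_def)
qed

lemma not_competitively_orientable_32211:
  "\<not> competitively_orientable (complete_multipartite [3, 2, 2, 1, 1])"
proof
  let ?V = "multipartite_verts [3, 2, 2, 1, 1]"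
  assume "competitively_orientable (complete_multipartite [3, 2, 2, 1, 1])"
  then obtain E where E: "competitive_rel ?V E"
    unfolding competitively_orientable_multipartite_iff ..
  have V: "?V = {(0, 0), (0, 1), (0, 2), (1, 0), (1, 1), (2, 0), (2, 1), (3, 0), (4, 0)}"
    unfolding multipartite_verts_set by (simp add: upt_rec insert_commute numeral_eq_Suc)
  \<comment> \<open>The condition \<open>fst u < fst v\<close> leaves one propositional variable for each edge.\<close>
  have clauses: "\<forall>u\<in>?V. \<forall>v\<in>?V. fst u = fst v \<longrightarrow> \<not> E u v"
    "\<forall>u\<in>?V. \<forall>v\<in>?V. fst u < fst v \<longrightarrow> (E v u \<longleftrightarrow> \<not> E u v)"
    "\<forall>x\<in>?V. \<forall>y\<in>?V. x \<noteq> y \<longrightarrow> (\<exists>z\<in>?V. E x z \<and> E y z)"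
  proof -
    show "\<forall>u\<in>?V. \<forall>v\<in>?V. fst u = fst v \<longrightarrow> \<not> E u v"
      using competitive_rel_arcD(1)[OF E] by blast
    show "\<forall>u\<in>?V. \<forall>v\<in>?V. fst u < fst v \<longrightarrow> (E v u \<longleftrightarrow> \<not> E u v)"
    proof (intro ballI impI)
      fix u v assume "u \<in> ?V" "v \<in> ?V" "fst u < fst v"
      then show "E v u \<longleftrightarrow> \<not> E u v"
        using competitive_rel_arc[OF E, of v u] by simp
    qed
    show "\<forall>x\<in>?V. \<forall>y\<in>?V. x \<noteq> y \<longrightarrow> (\<exists>z\<in>?V. E x z \<and> E y z)"
      using E unfolding competitive_rel_def by blast
  qed
  \<comment> \<open>The common out-neighbour \<open>w\<close> of the two single vertices fixes two
    edges per branch; \<open>w = (3, 0)\<close> and \<open>w = (4, 0)\<close> would be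
    loops.\<close>
  have "(3, 0) \<in> ?V" "(4, 0) \<in> ?V"
    unfolding V by simp_all
  then obtain w where w: "w \<in> ?V" "E (3, 0) w" "E (4, 0) w"
    by (rule competitive_rel_common[OF E]) simp
  from w(1) have "w = (0, 0) \<or> w = (0, 1) \<or> w = (0, 2) \<or> w = (1, 0) \<or> w = (1, 1) \<or>
      w = (2, 0) \<or> w = (2, 1) \<or> w = (3, 0) \<or> w = (4, 0)"
    unfolding V by simp
  \<comment> \<open>Branching on \<open>w\<close> makes each propositional problem small enough for \<open>argo\<close>.\<close>
  then show False
    by (elim disjE; insert clauses[unfolded V, simplified] w(2,3); hypsubst; argo)
qed

section \<open>Comparing the part sizes with the extremal cases\<close>

theorem theorem4:
  fixes n1 n2 n3 n4 n5 :: nat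
  assumes "n1 > 0" and "n2 > 0" and "n3 > 0" and "n4 > 0" and "n5 > 0"
    and "n1 \<ge> n2" and "n2 \<ge> n3" and "n3 \<ge> n4" and "n4 \<ge> n5"
  shows "competitively_orientable (complete_multipartite [n1, n2, n3, n4, n5]) \<longleftrightarrow>
      (n1 = 3 \<and> n2 = 3 \<and> n3 \<ge> 2 \<and> n4 = 1)
    \<or> (n1 \<ge> 4 \<and> n3 \<ge> 2 \<and> n4 = 1)
    \<or> n4 \<ge> 2"
proof
  assume "(n1 = 3 \<and> n2 = 3 \<and> n3 \<ge> 2 \<and> n4 = 1)
    \<or> (n1 \<ge> 4 \<and> n3 \<ge> 2 \<and> n4 = 1) \<or> n4 \<ge> 2"
  then show "competitively_orientable (complete_multipartite [n1, n2, n3, n4, n5])"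
  proof (elim disjE)
    assume "n1 = 3 \<and> n2 = 3 \<and> n3 \<ge> 2 \<and> n4 = 1"
    then show ?thesis
      using assms
      by (intro competitively_orientable_multipartite_mono[OF competitively_orientable_33211]) auto
  next
    assume "n1 \<ge> 4 \<and> n3 \<ge> 2 \<and> n4 = 1"
    then show ?thesis
      using assms
      by (intro competitively_orientable_multipartite_mono[OF competitively_orientable_42211]) auto
  next
    assume "n4 \<ge> 2"
    then show ?thesis
      using assms
      by (intro competitively_orientable_multipartite_mono[OF competitively_orientable_22221]) auto
  qed
next
  assume co: "competitively_orientable (complete_multipartite [n1, n2, n3, n4, n5])"
  show "(n1 = 3 \<and> n2 = 3 \<and> n3 \<ge> 2 \<and> n4 = 1)
    \<or> (n1 \<ge> 4 \<and> n3 \<ge> 2 \<and> n4 = 1) \<or> n4 \<ge> 2"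
  proof (rule ccontr)
    assume "\<not> ?thesis"
    then have n4: "n4 = 1" "n5 = 1" and small: "n3 = 1 \<or> n1 \<le> 3 \<and> n2 = 2 \<and> n3 = 2"
      using assms by auto
    from small show False
    proof
      assume "n3 = 1"
      then show False
        using co n4 not_competitively_orientable_three_singletons by simp
    next
      assume "n1 \<le> 3 \<and> n2 = 2 \<and> n3 = 2"
      \<comment> \<open>Here \<open>n1\<close> is 2 or 3; enlarging the first part to size 3 treats
        both values at once.\<close>
      then have "competitively_orientable (complete_multipartite [3, 2, 2, 1, 1])"
        using assms n4 by (intro competitively_orientable_multipartite_mono[OF co]) auto
      then show False
        using not_competitively_orientable_32211 by blast
    qed
  qed
qed

end
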